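(* Let $F$ be the error profile of a list of $n\ge2$ states in a finite-dimensional GPT state space, and let $H\subseteq[n]$ with $|H|=m\ge2$. Then $$F(H)\ge\max_{\mathcal T}\sum_{\{i,j\}\in E(\mathcal T)}F(\{i,j\})\ge\frac2m\sum_{\{i,j\}\subseteq H}F(\{i,j\}),$$ where the maximum is over all spanning trees $\mathcal T$ of the complete graph on vertex set $H$, $E(\mathcal T)$ is the edge set of $\mathcal T$, and the last sum is over all two-element subsets of $H$.
   Context: $[n]=\{1,\ldots,n\}$. A finite-dimensional GPT state space is a nonempty compact convex subset $K$ of some $\mathbb R^d$, $d\ge1$. A (finite-outcome) measurement on $K$ is a finite family $(e_x)_{x\in X}$ of nonnegative affine functions on $K$ with $\sum_{x}e_x=1$; every such family is allowed. For a list of (not necessarily distinct) states $s_1,\ldots,s_n\in K$ and nonempty $H\subseteq[n]$, $D(H)=\max\sum_{i\in H}e_i(s_i)$, the maximum over all measurements $(e_i)_{i\in H}$ indexed by $H$, and $F(H)=|H|-D(H)$; also $D(\varnothing)=F(\varnothing)=0$. $F$ is the error profile of the list. *)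

theory Defs
  imports "HOL-Analysis.Analysis"
begin

section \<open>State spaces and measurements\<close>

definition gpt_state_space :: "'a::euclidean_space set \<Rightarrow> bool" where
  "gpt_state_space K \<longleftrightarrow> K \<noteq> {} \<and> compact K \<and> convex K"

definition affine_fun_on :: "'a::real_vector set \<Rightarrow> ('a \<Rightarrow> real) \<Rightarrow> bool" where
  "affine_fun_on K f \<longleftrightarrow>
     (\<forall>x\<in>K. \<forall>y\<in>K. \<forall>t\<in>{0..1}. f ((1 - t) *\<^sub>R x + t *\<^sub>R y) = (1 - t) * f x + t * f y)"

definition measurement :: "'a::real_vector set \<Rightarrow> 'x set \<Rightarrow> ('x \<Rightarrow> 'a \<Rightarrow> real) \<Rightarrow> bool" where
  "measurement K X e \<longleftrightarrow>
     finite X \<and>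
     (\<forall>x\<in>X. affine_fun_on K (e x) \<and> (\<forall>p\<in>K. 0 \<le> e x p)) \<and>
     (\<forall>p\<in>K. (\<Sum>x\<in>X. e x p) = 1)"


section \<open>Error profile\<close>

text \<open>A list of states is a function \<open>s\<close> on indices, of which only the values on the relevant index
  set matter. The supremum below is a maximum (lemma \<open>discrimination_value_attained\<close>). The empty
  index set is a separate case because no measurement on a nonempty \<open>K\<close> has an empty outcome set.\<close>

definition discrimination_value :: "'a::real_vector set \<Rightarrow> ('i \<Rightarrow> 'a) \<Rightarrow> 'i set \<Rightarrow> real" where
  "discrimination_value K s H =
     (if H = {} then 0 else Sup {\<Sum>i\<in>H. e i (s i) | e. measurement K H e})"

definition error_profile :: "'a::real_vector set \<Rightarrow> ('i \<Rightarrow> 'a) \<Rightarrow> 'i set \<Rightarrow> real" where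
  "error_profile K s H = real (card H) - discrimination_value K s H"

lemma discrimination_value_attained:
  fixes K :: "'a::real_vector set" and s :: "'i \<Rightarrow> 'a"
  assumes "finite H" "H \<noteq> {}" "convex K" "\<And>i. i \<in> H \<Longrightarrow> s i \<in> K"
  shows "\<exists>e. measurement K H e \<and> (\<Sum>i\<in>H. e i (s i)) = discrimination_value K s H \<and>
           (\<forall>e'. measurement K H e' \<longrightarrow> (\<Sum>i\<in>H. e' i (s i)) \<le> discrimination_value K s H)"
proof -
  define B :: "('i \<times> 'a \<Rightarrow> real) set" where "B = (\<Pi>\<^sub>E z\<in>UNIV. {0..1})"
  define M where "M = B \<inter> {f. measurement K H (curry f)}"
  define v where "v f = (\<Sum>i\<in>H. f (i, s i))" for f :: "'i \<times> 'a \<Rightarrow> real"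
  have "compactin (product_topology (\<lambda>_::'i \<times> 'a. euclidean :: real topology) UNIV) B"
    unfolding B_def by (subst compactin_PiE) auto
  hence "compact B"
    by (simp add: euclidean_product_topology)
  have coord: "continuous_on UNIV (\<lambda>f::'i \<times> 'a \<Rightarrow> real. f z)" for z
    by (rule continuous_on_product_coordinates)
  have "closed {f::'i \<times> 'a \<Rightarrow> real. measurement K H (curry f)}"
    unfolding measurement_def affine_fun_on_def Ball_def curry_def
    using \<open>finite H\<close>
    by (intro closed_Collect_conj closed_Collect_all closed_Collect_imp closed_Collect_eq
          closed_Collect_le closed_Collect_const open_Collect_const continuous_intros coord)
  hence "compact M"
    unfolding M_def using \<open>compact B\<close> by (rule compact_Int_closed[rotated])
  obtain a where a: "a \<in> H" using assms(2) by auto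
  have "(\<lambda>z. if fst z = a then 1 else 0) \<in> M"
    using a assms(1) by (auto simp: M_def B_def measurement_def affine_fun_on_def curry_def)
  hence "M \<noteq> {}" by auto
  have "continuous_on M v"
    unfolding v_def by (intro continuous_on_sum continuous_on_subset[OF coord]) auto
  then obtain f where f: "f \<in> M" "\<And>g. g \<in> M \<Longrightarrow> v g \<le> v f"
    using continuous_attains_sup[OF \<open>compact M\<close> \<open>M \<noteq> {}\<close>] by blast
  have le: "(\<Sum>i\<in>H. e i (s i)) \<le> v f" if e: "measurement K H e" for e
  proof -
    define g where "g = (\<lambda>(i, p). if i \<in> H \<and> p \<in> K then e i p else 0)"
    have le1: "e i p \<le> 1" if "i \<in> H" "p \<in> K" for i p
    proof -
      have "e i p \<le> (\<Sum>x\<in>H. e x p)"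
        using e that assms(1) by (intro member_le_sum) (auto simp: measurement_def)
      thus ?thesis using e that by (simp add: measurement_def)
    qed
    have mem: "(1 - t) *\<^sub>R x + t *\<^sub>R y \<in> K" if "x \<in> K" "y \<in> K" "0 \<le> t" "t \<le> 1" for x y and t::real
      using assms(3) that by (simp add: convex_alt)
    have "measurement K H (curry g)"
      using e mem by (auto simp: measurement_def affine_fun_on_def g_def curry_def cong: sum.cong)
    moreover have "g \<in> B"
      using e le1 by (auto simp: B_def g_def measurement_def)
    ultimately have "g \<in> M" by (simp add: M_def)
    moreover have "v g = (\<Sum>i\<in>H. e i (s i))"
      unfolding v_def g_def using assms(4) by (intro sum.cong) auto
    ultimately show ?thesis using f(2) by fastforce
  qed
  have mf: "measurement K H (curry f)" using f(1) by (simp add: M_def)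
  have vf: "(\<Sum>i\<in>H. curry f i (s i)) = v f" by (simp add: v_def)
  have "Sup {\<Sum>i\<in>H. e i (s i) | e. measurement K H e} = v f"
    by (rule cSup_eq_maximum) (use mf vf le in \<open>force+\<close>)
  hence "discrimination_value K s H = v f"
    using assms(2) by (simp add: discrimination_value_def)
  thus ?thesis using mf vf le by auto
qed


section \<open>Spanning trees\<close>

text \<open>The edge set of a finite simple graph is a set of two-element vertex sets.\<close>

definition complete_edges :: "'v set \<Rightarrow> 'v set set" where
  "complete_edges V = {e. e \<subseteq> V \<and> card e = 2}"

definition graph_connected :: "'v set \<Rightarrow> 'v set set \<Rightarrow> bool" where
  "graph_connected V E \<longleftrightarrow> (\<forall>u\<in>V. \<forall>v\<in>V. (u, v) \<in> {(x, y). {x, y} \<in> E}\<^sup>*)"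

definition graph_cycle :: "'v set set \<Rightarrow> 'v list \<Rightarrow> bool" where
  "graph_cycle E c \<longleftrightarrow> length c \<ge> 3 \<and> distinct c \<and>
     (\<forall>i<length c. {c ! i, c ! (Suc i mod length c)} \<in> E)"

text \<open>\<open>T\<close> is the edge set of a spanning tree of the graph with vertex set \<open>V\<close> and edge set \<open>E\<close>.\<close>

definition spanning_tree :: "'v set \<Rightarrow> 'v set set \<Rightarrow> 'v set set \<Rightarrow> bool" where
  "spanning_tree V E T \<longleftrightarrow> T \<subseteq> E \<and> graph_connected V T \<and> \<not> (\<exists>c. graph_cycle T c)"

lemma finite_spanning_trees:
  assumes "finite V"
  shows "finite {T. spanning_tree V (complete_edges V) T}"
proof -
  have "{T. spanning_tree V (complete_edges V) T} \<subseteq> Pow (Pow V)"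
    by (auto simp: spanning_tree_def complete_edges_def)
  thus ?thesis by (rule finite_subset) (simp add: assms)
qed

lemma spanning_tree_star:
  assumes "a \<in> V"
  shows "spanning_tree V (complete_edges V) ((\<lambda>b. {a, b}) ` (V - {a}))"
    (is "spanning_tree V _ ?T")
proof -
  let ?R = "{(x, y). {x, y} \<in> ?T}"
  have "(a, u) \<in> ?R\<^sup>*" "(u, a) \<in> ?R\<^sup>*" if "u \<in> V" for u
    using that by (cases "u = a"; force simp: insert_commute)+
  hence "graph_connected V ?T"
    unfolding graph_connected_def by (meson rtrancl_trans)
  moreover have False if c: "graph_cycle ?T c" for c
  proof -
    let ?n = "length c"
    have n: "?n \<ge> 3" and d: "distinct c"
      and E: "\<And>i. i < ?n \<Longrightarrow> {c ! i, c ! (Suc i mod ?n)} \<in> ?T"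
      using c by (auto simp: graph_cycle_def)
    have hub: "c ! i = a \<or> c ! (Suc i mod ?n) = a" if "i < ?n" for i
      using E[OF that] by (auto simp: doubleton_eq_iff)
    have neq: "c ! i \<noteq> c ! j" if "i < ?n" "j < ?n" "i \<noteq> j" for i j
      using d that by (simp add: nth_eq_iff_index_eq)
    show False
    proof (cases "c ! 1 = a")
      case True
      have "2 < ?n" using n by simp
      hence "c ! 2 = a \<or> c ! (Suc 2 mod ?n) = a" by (rule hub)
      moreover have "c ! 2 \<noteq> c ! 1" using n by (intro neq) auto
      moreover have "c ! (Suc 2 mod ?n) \<noteq> c ! 1"
        using n by (intro neq) (auto simp: mod_if)
      ultimately show False using True by simp
    next
      case False
      have "c ! 0 = a \<or> c ! (Suc 0 mod ?n) = a" using n by (intro hub) linarith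
      moreover have "Suc 0 mod ?n = 1" using n by simp
      ultimately have "c ! 0 = a" using False by simp
      moreover have "c ! 1 = a \<or> c ! (Suc 1 mod ?n) = a" using n by (intro hub) linarith
      moreover have "Suc 1 mod ?n = 2" using n by simp
      ultimately have "c ! 0 = a" "c ! 2 = a" using False by simp_all
      moreover have "c ! 0 \<noteq> c ! 2" using n by (intro neq) auto
      ultimately show False by simp
    qed
  qed
  moreover have "?T \<subseteq> complete_edges V"
    using assms by (auto simp: complete_edges_def card_2_iff)
  ultimately show ?thesis by (auto simp: spanning_tree_def)
qed

end

theory Submission
  imports Defs
begin

text \<open>Merging outcomes turns a measurement on \<open>A \<union> B\<close>, where \<open>A \<inter> B = {c}\<close>, into one on \<open>A\<close> and one
  on \<open>B\<close>, by sending all outcomes outside to \<open>c\<close>. In the sum of the two success values every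
  index contributes its old term, and the extra terms at \<open>s c\<close> add up to 1. Hence
  \<open>F (A \<union> B) \<ge> F A + F B\<close>, and growing a spanning tree edge by edge gives the first inequality.
  The second one follows by averaging over the \<open>m\<close> stars, in which every edge occurs twice.\<close>

section \<open>Gluing error profiles\<close>

lemma affine_fun_on_sum:
  assumes "\<And>x. x \<in> X \<Longrightarrow> affine_fun_on K (e x)"
  shows "affine_fun_on K (\<lambda>p. \<Sum>x\<in>X. e x p)"
  using assms by (simp add: affine_fun_on_def sum.distrib sum_distrib_left)

text \<open>The fibres of \<open>f\<close> over \<open>Y\<close> partition \<open>X\<close>, so the
  merged effects still sum to 1. An outcome with empty fibre gets the zero effect.\<close>

lemma measurement_coarse_grain:
  assumes "measurement K X e" "finite Y" "f ` X \<subseteq> Y"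
  shows "measurement K Y (\<lambda>y p. \<Sum>x\<in>{x\<in>X. f x = y}. e x p)"
  using assms by (auto simp: measurement_def sum.group intro!: affine_fun_on_sum sum_nonneg)

lemma measurement_value_le:
  fixes K :: "'a::real_vector set"
  assumes "measurement K H e" "H \<noteq> {}" "convex K" "\<And>i. i \<in> H \<Longrightarrow> s i \<in> K"
  shows "(\<Sum>i\<in>H. e i (s i)) \<le> discrimination_value K s H"
  using discrimination_value_attained[of H K s] assms by (auto simp: measurement_def)

lemma discrimination_value_glue:
  fixes K :: "'a::real_vector set"
  assumes "finite A" "finite B" "A \<inter> B = {c}" "convex K" "\<And>i. i \<in> A \<union> B \<Longrightarrow> s i \<in> K"
  shows "discrimination_value K s (A \<union> B) + 1 \<le> discrimination_value K s A + discrimination_value K s B"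
proof -
  have "\<exists>e. measurement K (A \<union> B) e \<and>
      (\<Sum>i\<in>A \<union> B. e i (s i)) = discrimination_value K s (A \<union> B)"
    using discrimination_value_attained[of "A \<union> B" K s] assms by blast
  then obtain e where e: "measurement K (A \<union> B) e"
    and val: "(\<Sum>i\<in>A \<union> B. e i (s i)) = discrimination_value K s (A \<union> B)" by blast
  \<comment> \<open>The optimal \<open>e\<close> is merged along \<open>?f\<close>, which fixes
    \<open>C\<close> and sends the rest to \<open>c\<close>: only the fibre over \<open>c\<close>
    can grow, by \<open>D - C\<close>. The pair \<open>C\<close>, \<open>D\<close> is generic
    because both orders of \<open>A\<close> and \<open>B\<close> are used.\<close>
  have part: "(\<Sum>i\<in>C - {c}. e i (s i)) + (e c (s c) + (\<Sum>j\<in>D - C. e j (s c)))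
      \<le> discrimination_value K s C"
    if CD: "C \<union> D = A \<union> B" "c \<in> C" "finite C" "finite D" for C D
  proof -
    let ?f = "\<lambda>i. if i \<in> C then i else c"
    let ?g = "\<lambda>y p. \<Sum>x\<in>{x\<in>A \<union> B. ?f x = y}. e x p"
    have "measurement K C ?g"
      using e CD by (intro measurement_coarse_grain) auto
    hence "(\<Sum>i\<in>C. ?g i (s i)) \<le> discrimination_value K s C"
      using CD assms by (intro measurement_value_le) auto
    moreover have "(\<Sum>i\<in>C. ?g i (s i)) = ?g c (s c) + (\<Sum>i\<in>C - {c}. ?g i (s i))"
      using CD by (intro sum.remove)
    moreover have "{x \<in> A \<union> B. ?f x = c} = insert c (D - C)"
      using CD by auto
    moreover have "(\<Sum>i\<in>C - {c}. ?g i (s i)) = (\<Sum>i\<in>C - {c}. e i (s i))"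
    proof (rule sum.cong[OF refl])
      fix i assume "i \<in> C - {c}"
      hence "{x \<in> A \<union> B. ?f x = i} = {i}" using CD by auto
      thus "?g i (s i) = e i (s i)" by simp
    qed
    ultimately show ?thesis using CD by simp
  qed
  have c: "c \<in> A" "c \<in> B" and AB: "A - B = A - {c}" "B - A = B - {c}" using assms(3) by auto
  have split: "(\<Sum>i\<in>A \<union> B. h i) = h c + (\<Sum>i\<in>A - {c}. h i) + (\<Sum>i\<in>B - {c}. h i)" for h :: "'b \<Rightarrow> real"
  proof -
    have "A \<union> B = insert c ((A - {c}) \<union> (B - {c}))" using c by auto
    moreover have "(A - {c}) \<inter> (B - {c}) = {}" using assms(3) by auto
    ultimately show ?thesis
      using assms(1,2) by (simp add: sum.union_disjoint)
  qed
  \<comment> \<open>Source of the constant 1. The term \<open>e c (s c)\<close> occurs in both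
    merged values: one copy completes the value of \<open>e\<close>, the other completes this total
    probability at \<open>s c\<close>.\<close>
  have "(\<Sum>i\<in>A \<union> B. e i (s c)) = 1"
    using e assms(5) c by (simp add: measurement_def)
  moreover have "(\<Sum>i\<in>A - {c}. e i (s i)) + (e c (s c) + (\<Sum>j\<in>B - {c}. e j (s c)))
      \<le> discrimination_value K s A"
    using part[of A B] c AB assms(1,2) by simp
  moreover have "(\<Sum>i\<in>B - {c}. e i (s i)) + (e c (s c) + (\<Sum>j\<in>A - {c}. e j (s c)))
      \<le> discrimination_value K s B"
    using part[of B A] c AB assms(1,2) by (simp add: Un_commute)
  ultimately show ?thesis
    using val split[of "\<lambda>i. e i (s i)"] split[of "\<lambda>i. e i (s c)"] by linarith
qed

text \<open>Since \<open>c\<close> is counted twice, \<open>card A + card B\<close> exceeds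
  \<open>card (A \<union> B)\<close> by 1, which cancels the 1 gained in
  \<open>discrimination_value_glue\<close>.\<close>

lemma error_profile_glue:
  fixes K :: "'a::real_vector set"
  assumes "finite A" "finite B" "A \<inter> B = {c}" "convex K" "\<And>i. i \<in> A \<union> B \<Longrightarrow> s i \<in> K"
  shows "error_profile K s A + error_profile K s B \<le> error_profile K s (A \<union> B)"
  using discrimination_value_glue[OF assms(1-4), of s] card_Un_Int[of A B] assms(1-3,5)
  by (simp add: error_profile_def)

text \<open>A measurement with a single outcome is constantly 1 on \<open>K\<close>, so the
  discrimination value is 1.\<close>

lemma error_profile_singleton:
  fixes K :: "'a::real_vector set"
  assumes "convex K" "s i \<in> K"
  shows "error_profile K s {i} = 0"
  using discrimination_value_attained[of "{i}" K s] assms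
  by (auto simp: error_profile_def measurement_def)

section \<open>Spanning trees\<close>

text \<open>Vertex lists match the format of \<open>graph_cycle\<close>. Confinement to
  \<open>A\<close> keeps a path distinct when a vertex outside \<open>A\<close> is added.\<close>

definition path_between :: "'v set set \<Rightarrow> 'v set \<Rightarrow> 'v \<Rightarrow> 'v \<Rightarrow> 'v list \<Rightarrow> bool" where
  "path_between E A u v p \<longleftrightarrow> p \<noteq> [] \<and> hd p = u \<and> last p = v \<and> distinct p \<and> set p \<subseteq> A \<and>
     successively (\<lambda>x y. {x, y} \<in> E) p"

lemma path_between_rev: "path_between E A u v p \<Longrightarrow> path_between E A v u (rev p)"
  by (simp add: path_between_def hd_rev last_rev insert_commute)

lemma path_between_snoc:
  assumes "path_between E A u x p" "{x, y} \<in> E" "y \<notin> A"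
  shows "path_between E (insert y A) u y (p @ [y])"
  using assms by (auto simp: path_between_def successively_append_iff)

lemma graph_cycle_Cons:
  assumes p: "path_between E A u v p" and "u \<noteq> v" "y \<notin> A" "{u, y} \<in> E" "{v, y} \<in> E"
  shows "graph_cycle E (y # p)"
  unfolding graph_cycle_def
proof (intro conjI allI impI)
  \<comment> \<open>\<open>remdups_adj.cases\<close> supplies the split into lists of length 0, 1
    and at least 2; the first two contradict \<open>p \<noteq> []\<close> and
    \<open>u \<noteq> v\<close>.\<close>
  have len: "length p \<ge> 2"
    using p \<open>u \<noteq> v\<close> by (cases p rule: remdups_adj.cases) (auto simp: path_between_def)
  thus "3 \<le> length (y # p)" by simp
  show "distinct (y # p)" using assms by (auto simp: path_between_def)
  fix i assume i: "i < length (y # p)"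
  show "{(y # p) ! i, (y # p) ! (Suc i mod length (y # p))} \<in> E"
  proof (cases i)
    case 0
    thus ?thesis using assms len by (auto simp: path_between_def hd_conv_nth insert_commute)
  next
    case (Suc j)
    show ?thesis
    proof (cases "Suc j = length p")
      \<comment> \<open>At the last vertex the successor index wraps round to 0, so the edge in
        question is \<open>{v, y}\<close>.\<close>
      case True
      hence "j = length p - 1" by simp
      hence "(y # p) ! i = v" using p Suc by (auto simp: path_between_def last_conv_nth)
      thus ?thesis using True Suc assms by simp
    next
      case False
      hence "{p ! j, p ! Suc j} \<in> E"
        using p i Suc by (auto simp: path_between_def successively_conv_nth)
      thus ?thesis using Suc i False by simp
    qed
  qed
qed

text \<open>Induction along a walk from \<open>a\<close> to \<open>v\<close>: either its current end
  is still in \<open>A\<close>, or some edge has already left \<open>A\<close>.\<close>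

lemma graph_connected_crossing_edge:
  assumes "graph_connected V E" "a \<in> A" "v \<notin> A" "a \<in> V" "v \<in> V"
  obtains x y where "x \<in> A" "y \<notin> A" "{x, y} \<in> E"
proof -
  have "(a, v) \<in> {(x, y). {x, y} \<in> E}\<^sup>*"
    using assms by (auto simp: graph_connected_def)
  hence "v \<in> A \<or> (\<exists>x y. x \<in> A \<and> y \<notin> A \<and> {x, y} \<in> E)"
    by (induction rule: rtrancl_induct) (use \<open>a \<in> A\<close> in auto)
  thus ?thesis using assms that by blast
qed

section \<open>Growing a spanning tree vertex by vertex\<close>

text \<open>A connected piece \<open>A\<close> of the tree grows by one vertex \<open>y\<close> at a
  time. Acyclicity ensures that \<open>y\<close> brings in exactly one tree edge, whose weight is
  paid for by \<open>grow\<close>.\<close>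

lemma spanning_tree_sum_le:
  fixes g :: "'v set \<Rightarrow> real"
  assumes "finite V" "V \<noteq> {}" and T: "spanning_tree V (complete_edges V) T"
    and single: "\<And>a. a \<in> V \<Longrightarrow> 0 \<le> g {a}"
    and grow: "\<And>A x y. A \<subseteq> V \<Longrightarrow> x \<in> A \<Longrightarrow> y \<in> V - A \<Longrightarrow> g A + g {x, y} \<le> g (insert y A)"
  shows "(\<Sum>e\<in>T. g e) \<le> g V"
proof -
  have TV: "\<And>e. e \<in> T \<Longrightarrow> e \<subseteq> V \<and> card e = 2" and conn: "graph_connected V T"
    and acyc: "\<And>c. \<not> graph_cycle T c"
    using T by (auto simp: spanning_tree_def complete_edges_def)
  have finT: "finite T"
    using TV assms(1) by (intro finite_subset[of T "Pow V"]) auto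
  \<comment> \<open>Growth starts from a single vertex, hence \<open>Suc k\<close>. The paths inside
    \<open>A\<close> are part of the invariant because they turn a second edge from \<open>y\<close>
    into \<open>A\<close> into a cycle.\<close>
  have tree: "\<exists>A\<subseteq>V. card A = Suc k \<and> (\<forall>u\<in>A. \<forall>v\<in>A. \<exists>p. path_between T A u v p) \<and>
      (\<Sum>e\<in>{e\<in>T. e \<subseteq> A}. g e) \<le> g A" if "Suc k \<le> card V" for k
    using that
  proof (induction k)
    case 0
    obtain a where a: "a \<in> V" using assms(2) by auto
    have empty: "{e\<in>T. e \<subseteq> {a}} = {}" using TV by (fastforce simp: subset_singleton_iff)
    have "path_between T {a} a a [a]" by (simp add: path_between_def)
    thus ?case using a single[OF a] unfolding One_nat_def[symmetric]
      by (intro exI[of _ "{a}"]) (auto simp: empty)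
  next
    case (Suc k)
    from Suc.IH[OF Suc_leD[OF Suc.prems]] obtain A where A: "A \<subseteq> V" "card A = Suc k"
      and path: "\<And>u v. u \<in> A \<Longrightarrow> v \<in> A \<Longrightarrow> \<exists>p. path_between T A u v p"
      and le: "(\<Sum>e\<in>{e\<in>T. e \<subseteq> A}. g e) \<le> g A"
      by blast
    have finA: "finite A" using A assms(1) finite_subset by blast
    obtain a where a: "a \<in> A" using A by fastforce
    have "A \<noteq> V" using A Suc.prems by auto
    then obtain v where "v \<in> V" "v \<notin> A" using A by auto
    then obtain x y where xy: "x \<in> A" "y \<notin> A" "{x, y} \<in> T"
      using graph_connected_crossing_edge[OF conn a] a A by blast
    have y: "y \<in> V" using TV[OF xy(3)] by auto
    have uniq: "x' = x" if x': "x' \<in> A" "{x', y} \<in> T" for x'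
    proof (rule ccontr)
      assume neq: "x' \<noteq> x"
      obtain p where "path_between T A x' x p" using path x' xy by blast
      thus False using graph_cycle_Cons neq xy x' acyc by metis
    qed
    have new: "e = {x, y}" if e: "e \<in> T" "e \<subseteq> insert y A" "\<not> e \<subseteq> A" for e
    proof -
      obtain u w where uw: "e = {u, w}" "u \<noteq> w" using TV[OF e(1)] by (auto simp: card_2_iff)
      with e consider "u = y" "w \<in> A" | "w = y" "u \<in> A" by auto
      thus ?thesis using uniq e(1) uw by cases (auto simp: insert_commute)
    qed
    have edges: "{e\<in>T. e \<subseteq> insert y A} = insert {x, y} {e\<in>T. e \<subseteq> A}"
      using new xy by blast
    have "(\<Sum>e\<in>{e\<in>T. e \<subseteq> insert y A}. g e) = g {x, y} + (\<Sum>e\<in>{e\<in>T. e \<subseteq> A}. g e)"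
      unfolding edges using finT xy by (subst sum.insert) auto
    also have "\<dots> \<le> g (insert y A)"
      using grow[of A x y] A xy y le by auto
    finally have sum: "(\<Sum>e\<in>{e\<in>T. e \<subseteq> insert y A}. g e) \<le> g (insert y A)" .
    have to_y: "\<exists>p. path_between T (insert y A) u y p" if u: "u \<in> A" for u
      using path[OF u xy(1)] path_between_snoc xy by metis
    have "\<exists>p. path_between T (insert y A) u v p" if uv: "u \<in> insert y A" "v \<in> insert y A" for u v
    proof -
      consider "u = y" "v = y" | "u = y" "v \<in> A" | "u \<in> A" "v = y" | "u \<in> A" "v \<in> A"
        using uv by auto
      thus ?thesis
      proof cases
        case 1
        hence "path_between T (insert y A) u v [y]" by (simp add: path_between_def)
        thus ?thesis ..
      next
        case 2
        thus ?thesis using to_y path_between_rev by metis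
      next
        case 3
        thus ?thesis using to_y by simp
      next
        case 4
        thus ?thesis using path[OF 4] by (auto simp: path_between_def)
      qed
    qed
    thus ?case using A finA xy y sum
      by (intro exI[of _ "insert y A"]) auto
  qed
  have V: "Suc (card V - 1) = card V" using assms(1,2) by (simp add: card_gt_0_iff)
  obtain A where A: "A \<subseteq> V" "card A = card V" "(\<Sum>e\<in>{e\<in>T. e \<subseteq> A}. g e) \<le> g A"
    using tree[of "card V - 1"] unfolding V by blast
  have "A = V" using A assms(1) by (simp add: card_subset_eq)
  moreover have "{e\<in>T. e \<subseteq> V} = T" using TV by auto
  ultimately show ?thesis using A by simp
qed

section \<open>Averaging over stars\<close>

text \<open>Double counting of incident pairs: the star at \<open>a\<close> consists of the edges
  containing \<open>a\<close>, and each edge has two endpoints.\<close>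

lemma sum_stars:
  fixes g :: "'v set \<Rightarrow> real"
  assumes "finite V"
  shows "(\<Sum>a\<in>V. \<Sum>e\<in>(\<lambda>b. {a, b}) ` (V - {a}). g e) = 2 * (\<Sum>e\<in>complete_edges V. g e)"
proof -
  have fin: "finite (complete_edges V)"
    using assms by (intro finite_subset[of "complete_edges V" "Pow V"]) (auto simp: complete_edges_def)
  have star: "(\<lambda>b. {a, b}) ` (V - {a}) = {e\<in>complete_edges V. a \<in> e}" if "a \<in> V" for a
  proof (intro set_eqI iffI)
    fix e assume "e \<in> {e\<in>complete_edges V. a \<in> e}"
    then obtain x y where "e = {x, y}" "x \<noteq> y" "e \<subseteq> V" "a \<in> e"
      by (auto simp: complete_edges_def card_2_iff)
    thus "e \<in> (\<lambda>b. {a, b}) ` (V - {a})"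
      by (cases "a = x") (auto simp: insert_commute)
  qed (use that in \<open>auto simp: complete_edges_def card_2_iff\<close>)
  have "(\<Sum>a\<in>V. \<Sum>e\<in>(\<lambda>b. {a, b}) ` (V - {a}). g e) = (\<Sum>a\<in>V. \<Sum>e\<in>{e\<in>complete_edges V. a \<in> e}. g e)"
    using star by simp
  also have "\<dots> = (\<Sum>e\<in>complete_edges V. \<Sum>a\<in>{a\<in>V. a \<in> e}. g e)"
    by (rule sum.swap_restrict[OF assms fin])
  also have "\<dots> = (\<Sum>e\<in>complete_edges V. 2 * g e)"
  proof (rule sum.cong[OF refl])
    fix e assume "e \<in> complete_edges V"
    hence "{a\<in>V. a \<in> e} = e" "card e = 2" by (auto simp: complete_edges_def)
    thus "(\<Sum>a\<in>{a\<in>V. a \<in> e}. g e) = 2 * g e" by simp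
  qed
  finally show ?thesis by (simp add: sum_distrib_left)
qed

section \<open>The two inequalities\<close>

text \<open>The growth condition is \<open>error_profile_glue\<close> for \<open>A\<close> and
  \<open>{x, y}\<close>, which meet exactly in \<open>x\<close>; singletons have error 0.\<close>

lemma error_profile_ge_spanning_tree:
  fixes K :: "'a::real_vector set"
  assumes H: "finite H" "H \<noteq> {}" and K: "convex K" "\<And>i. i \<in> H \<Longrightarrow> s i \<in> K"
    and T: "spanning_tree H (complete_edges H) T"
  shows "(\<Sum>e\<in>T. error_profile K s e) \<le> error_profile K s H"
proof (rule spanning_tree_sum_le[OF H T])
  show "0 \<le> error_profile K s {a}" if "a \<in> H" for a
    using error_profile_singleton[of K s a] K that by simp
  fix A x y assume A: "A \<subseteq> H" "x \<in> A" "y \<in> H - A"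
  have "A \<union> {x, y} = insert y A" using A by auto
  moreover have "error_profile K s A + error_profile K s {x, y} \<le> error_profile K s (A \<union> {x, y})"
    using A H finite_subset K by (intro error_profile_glue[of _ _ x]) auto
  ultimately show "error_profile K s A + error_profile K s {x, y} \<le> error_profile K s (insert y A)"
    by simp
qed

text \<open>Each star is a spanning tree, so its weight is at most \<open>?M\<close>; summing over
  all centres and applying \<open>sum_stars\<close> gives the bound for arbitrary edge
  weights.\<close>

lemma Max_spanning_tree_ge_average:
  fixes g :: "'v set \<Rightarrow> real"
  assumes "finite V" "V \<noteq> {}"
  shows "2 / real (card V) * (\<Sum>e\<in>complete_edges V. g e)
    \<le> (MAX T\<in>{T. spanning_tree V (complete_edges V) T}. \<Sum>e\<in>T. g e)" (is "_ \<le> ?M")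
proof -
  have "2 * (\<Sum>e\<in>complete_edges V. g e) = (\<Sum>a\<in>V. \<Sum>e\<in>(\<lambda>b. {a, b}) ` (V - {a}). g e)"
    by (rule sum_stars[OF assms(1), symmetric])
  also have "\<dots> \<le> (\<Sum>a\<in>V. ?M)"
    using finite_spanning_trees[OF assms(1)] spanning_tree_star
    by (intro sum_mono Max_ge finite_imageI imageI) auto
  also have "\<dots> = real (card V) * ?M" by simp
  finally show ?thesis using assms by (simp add: field_simps card_gt_0_iff)
qed

theorem corollary2p4:
  fixes K :: "'a::euclidean_space set" and s :: "nat \<Rightarrow> 'a" and n m :: nat and H :: "nat set"
  assumes "gpt_state_space K"
    and "n \<ge> 2"
    and "\<And>i. i \<in> {1..n} \<Longrightarrow> s i \<in> K"
    and "H \<subseteq> {1..n}"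
    and "card H = m"
    and "m \<ge> 2"
  shows "error_profile K s H
           \<ge> (MAX T\<in>{T. spanning_tree H (complete_edges H) T}. \<Sum>e\<in>T. error_profile K s e)
       \<and> (MAX T\<in>{T. spanning_tree H (complete_edges H) T}. \<Sum>e\<in>T. error_profile K s e)
           \<ge> 2 / real m * (\<Sum>e\<in>complete_edges H. error_profile K s e)"
proof -
  have H: "finite H" "H \<noteq> {}" using assms(4-6) finite_subset by auto
  then obtain a where "a \<in> H" by auto
  \<comment> \<open>\<open>Max\<close> can be bounded from above only over a nonempty set; the star
    at \<open>a\<close> provides a member.\<close>
  hence "{T. spanning_tree H (complete_edges H) T} \<noteq> {}" using spanning_tree_star[of a H] by auto
  moreover have "convex K" "\<And>i. i \<in> H \<Longrightarrow> s i \<in> K"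
    using assms by (auto simp: gpt_state_space_def)
  ultimately show ?thesis
    using error_profile_ge_spanning_tree[OF H, of K s] finite_spanning_trees[OF H(1)]
      Max_spanning_tree_ge_average[OF H, of "error_profile K s"] assms(5)
    by (auto intro!: Max.boundedI)
qed

end
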